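(* Let $(\Omega,\mu)$ be a probability space, $n\ge 1$ an integer and $C\ge 1$. Assume that $\Omega$ can be partitioned into $2n$ disjoint measurable sets of equal measure $\frac{1}{2n}$. Then every Monte Carlo method $S_n$ (adaptive or not) that uses $n$ values of $f$ and $\rho$ satisfies $$ e(S_n,\mathcal F_C(\Omega))\ \ge\ \frac{\sqrt 2}{6}\cdot \begin{cases} \sqrt{\dfrac{C}{2n}}, & \text{if } 2n\ge C-1,\\[2mm] \dfrac{3C}{C+2n-1}, & \text{if } 2n< C-1. \end{cases} $$
   Context: Input class: $\mathcal F_C(\Omega)$ is the set of all pairs $(f,\rho)$ of measurable functions $f,\rho:\Omega\to\mathbb R$ with $\|f\|_\infty\le 1$ (i.e. $|f(x)|\le 1$ for all $x\in\Omega$), $\rho>0$, and $\rho(x)/\rho(y)\le C$ for all $x,y\in\Omega$. Solution operator: $S(f,\rho)=\dfrac{\int_\Omega f(x)\rho(x)\,\mu(dx)}{\int_\Omega\rho(x)\,\mu(dx)}$. Monte Carlo method using $n$ values of $f$ and $\rho$: there are random elements (random numbers) $\omega_1,\dots,\omega_n$, whose law does not depend on the input $(f,\rho)$ (otherwise no restriction is imposed on the random number generator); the first node is $x_1=x_1(\omega_1)\in\Omega$; for $i=2,\dots,n$ the node is $x_i=x_i\big(f(x_1),\dots,f(x_{i-1}),\rho(x_1),\dots,\rho(x_{i-1}),\omega_i\big)\in\Omega$; after each node is chosen, $f(x_i)$ and $\rho(x_i)$ are computed; the output is $S_n(f,\rho)=\phi_n\big(f(x_1),\dots,f(x_n),\rho(x_1),\dots,\rho(x_n)\big)\in\mathbb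 R$ for an arbitrary mapping $\phi_n:\mathbb R^{2n}\to\mathbb R$. All mappings are assumed such that the expectations below make sense (measurability). Error: $e(S_n,(f,\rho))=\big(\mathbf E|S(f,\rho)-S_n(f,\rho)|^2\big)^{1/2}$, where $\mathbf E$ is the expectation over the random numbers, and $e(S_n,\mathcal F_C(\Omega))=\sup_{(f,\rho)\in\mathcal F_C(\Omega)}e(S_n,(f,\rho))$. *)

theory Defs
  imports "HOL-Probability.Probability"
begin

definition input_class :: "'a measure \<Rightarrow> real \<Rightarrow> (('a \<Rightarrow> real) \<times> ('a \<Rightarrow> real)) set" where
  "input_class M C = {(f, \<rho>).
     f \<in> borel_measurable M \<and> \<rho> \<in> borel_measurable M \<and>
     (\<forall>x\<in>space M. \<bar>f x\<bar> \<le> 1) \<and>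
     (\<forall>x\<in>space M. 0 < \<rho> x) \<and>
     (\<forall>x\<in>space M. \<forall>y\<in>space M. \<rho> x / \<rho> y \<le> C)}"

definition solution :: "'a measure \<Rightarrow> ('a \<Rightarrow> real) \<Rightarrow> ('a \<Rightarrow> real) \<Rightarrow> real" where
  "solution M f \<rho> = (\<integral>x. f x * \<rho> x \<partial>M) / (\<integral>x. \<rho> x \<partial>M)"

text \<open>
  The random numbers are random elements \<open>noise S i\<close>, for \<open>i = 1, \<dots>, n\<close>, on one
  probability space \<open>rng S\<close>, with values in arbitrary measurable spaces; their joint law is
  arbitrary, and in particular independence is not required. The map \<open>node S i\<close> receives the
  lists of the values of \<open>f\<close> and \<open>\<rho>\<close> at the first \<open>i - 1\<close> nodes (oldest first) and the
  value of the \<open>i\<close>-th random element. The map \<open>final S\<close> is the deterministic map that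
  produces the output from the two lists of \<open>n\<close> values.
\<close>

record ('a, 'w, 'r) monte_carlo =
  rng :: "'w measure"
  noise_space :: "nat \<Rightarrow> 'r measure"
  noise :: "nat \<Rightarrow> 'w \<Rightarrow> 'r"
  node :: "nat \<Rightarrow> real list \<Rightarrow> real list \<Rightarrow> 'r \<Rightarrow> 'a"
  final :: "real list \<Rightarrow> real list \<Rightarrow> real"

text \<open>\<open>mc_nodes S f \<rho> w i\<close> is the list of the first \<open>i\<close> nodes, for the outcome \<open>w\<close>.\<close>

primrec mc_nodes ::
  "('a, 'w, 'r) monte_carlo \<Rightarrow> ('a \<Rightarrow> real) \<Rightarrow> ('a \<Rightarrow> real) \<Rightarrow> 'w \<Rightarrow> nat \<Rightarrow> 'a list" where
  "mc_nodes S f \<rho> w 0 = []"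
| "mc_nodes S f \<rho> w (Suc i) =
     (let xs = mc_nodes S f \<rho> w i
      in xs @ [node S (Suc i) (map f xs) (map \<rho> xs) (noise S (Suc i) w)])"

definition mc_output ::
  "('a, 'w, 'r) monte_carlo \<Rightarrow> nat \<Rightarrow> ('a \<Rightarrow> real) \<Rightarrow> ('a \<Rightarrow> real) \<Rightarrow> 'w \<Rightarrow> real" where
  "mc_output S n f \<rho> w =
     (let xs = mc_nodes S f \<rho> w n in final S (map f xs) (map \<rho> xs))"

text \<open>
  The only measurability required of the maps \<open>node S i\<close> and \<open>final S\<close> is that the output is
  a random variable for each admissible input.
\<close>

definition is_monte_carlo_method ::
  "'a measure \<Rightarrow> (('a \<Rightarrow> real) \<times> ('a \<Rightarrow> real)) set \<Rightarrow> nat \<Rightarrow> ('a, 'w, 'r) monte_carlo \<Rightarrow> bool" where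
  "is_monte_carlo_method M F n S \<longleftrightarrow>
     prob_space (rng S) \<and>
     (\<forall>i\<in>{1..n}. noise S i \<in> rng S \<rightarrow>\<^sub>M noise_space S i) \<and>
     (\<forall>i\<in>{1..n}. \<forall>ys zs. \<forall>r\<in>space (noise_space S i).
        length ys = i - 1 \<longrightarrow> length zs = i - 1 \<longrightarrow> node S i ys zs r \<in> space M) \<and>
     (\<forall>(f, \<rho>)\<in>F. mc_output S n f \<rho> \<in> borel_measurable (rng S))"

definition ennreal_sqrt :: "ennreal \<Rightarrow> ennreal" where
  "ennreal_sqrt x = (if x = \<infinity> then \<infinity> else ennreal (sqrt (enn2real x)))"

text \<open>
  The error has values in \<open>[0, \<infinity>]\<close>, because the output need not be square integrable.
\<close>

definition mc_error ::
  "'a measure \<Rightarrow> ('a, 'w, 'r) monte_carlo \<Rightarrow> nat \<Rightarrow> ('a \<Rightarrow> real) \<Rightarrow> ('a \<Rightarrow> real) \<Rightarrow> ennreal" where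
  "mc_error M S n f \<rho> =
     ennreal_sqrt (\<integral>\<^sup>+w. ennreal (\<bar>solution M f \<rho> - mc_output S n f \<rho> w\<bar>\<^sup>2) \<partial>rng S)"

definition worst_case_error ::
  "'a measure \<Rightarrow> (('a \<Rightarrow> real) \<times> ('a \<Rightarrow> real)) set \<Rightarrow> ('a, 'w, 'r) monte_carlo \<Rightarrow> nat \<Rightarrow> ennreal" where
  "worst_case_error M F S n = (SUP (f, \<rho>)\<in>F. mc_error M S n f \<rho>)"

end

theory Submission
  imports Defs
begin

text \<open>
  The proof compares the worst case with an average over finitely many inputs. Let \<open>g\<close> assign
  a value in \<open>{-1, 0, 1}\<close> to each of the \<open>2n\<close> cells, uniformly among the patterns with exactly
  \<open>m\<close> nonzero values. On a cell where \<open>g \<noteq> 0\<close> the density is \<open>C\<close> and the integrand is the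
  random sign \<open>g\<close>; elsewhere the density is \<open>1\<close> and the integrand is \<open>0\<close>. Since \<open>m\<close> is
  fixed, \<open>\<integral>\<rho>\<close> does not depend on \<open>g\<close>, and the quantity to be computed is
  \<open>\<kappa> \<Sum>g\<close> with \<open>\<kappa> = C / (2n + (C - 1) m)\<close>.

  For a fixed outcome of the random numbers the algorithm is a decision tree that reads \<open>g\<close> on
  at most \<open>n\<close> cells. Two symmetries of the uniform distribution on patterns bound its error.
  The signs on the cells that were not read can be flipped without the algorithm noticing, so
  they act as independent signs, and the mean square error is at least \<open>\<kappa>\<^sup>2\<close> times the mean
  number of nonzero cells left unread (\<open>sum_square_error_ge_hidden_support\<close>). Values on
  unread cells can be exchanged, so the fraction of nonzero cells among the unread ones is a
  martingale along the run, however adaptive the choice of nodes; hence at least \<open>m/2\<close> nonzero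
  cells are left unread on average (\<open>sum_hidden_support_ge\<close>). Every expectation here is a finite
  sum, and every symmetry an involution under which a summand changes its sign.

  The resulting bound \<open>\<kappa>\<^sup>2 m / 2\<close> is uniform in the random numbers. Integrating over them and
  exchanging the integral with the sum over \<open>g\<close> yields one pattern for which the method has mean
  square error at least \<open>\<kappa>\<^sup>2 m / 2\<close>. The two cases of the theorem come from the choice of \<open>m\<close>
  (\<open>exists_good_support_size\<close>): a single heavy cell if \<open>C - 1 > 2n\<close>, and otherwise so many that
  they add to \<open>2n\<close> a mass \<open>(C - 1) m\<close> of comparable size, or all cells if \<open>C\<close> is small.
\<close>

section \<open>Adaptive queries to a random sparse sign pattern\<close>

definition sparse_signs :: "'a set \<Rightarrow> nat \<Rightarrow> ('a \<Rightarrow> real) set" where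
  "sparse_signs I m =
     {g. (\<forall>i. g i \<in> {- 1, 0, 1}) \<and> {i. g i \<noteq> 0} \<subseteq> I \<and> card {i. g i \<noteq> 0} = m}"

lemma finite_sparse_signs:
  assumes "finite I"
  shows "finite (sparse_signs I m)"
proof (rule finite_subset)
  show "finite {g::'a \<Rightarrow> real. \<forall>i. (i \<in> I \<longrightarrow> g i \<in> {- 1, 0, 1}) \<and> (i \<notin> I \<longrightarrow> g i = 0)}"
    by (rule finite_set_of_finite_funs) (use assms in auto)
qed (auto simp: sparse_signs_def)

lemma sparse_signs_nonempty:
  assumes "m \<le> card I"
  shows "sparse_signs I m \<noteq> {}"
proof -
  obtain J where J: "J \<subseteq> I" "card J = m"
    using assms by (meson obtain_subset_with_card_n)
  have "{i. indicator J i \<noteq> (0::real)} = J"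
    by (auto simp: indicator_def)
  with J have "(indicator J :: 'a \<Rightarrow> real) \<in> sparse_signs I m"
    by (auto simp: sparse_signs_def indicator_def)
  then show ?thesis
    by blast
qed

lemma sparse_signs_values:
  "g \<in> sparse_signs I m \<Longrightarrow> g i \<in> {- 1, 0, 1}"
  by (simp add: sparse_signs_def)

lemma sparse_signs_abs_sum:
  assumes "g \<in> sparse_signs I m" "finite I"
  shows "(\<Sum>i\<in>I. \<bar>g i\<bar>) = real m"
proof -
  have *: "\<bar>g i\<bar> = (if g i \<noteq> 0 then 1 else 0)" for i
    using sparse_signs_values[OF assms(1), of i] by auto
  have "(\<Sum>i\<in>I. \<bar>g i\<bar>) = real (card (I \<inter> {i. g i \<noteq> 0}))"
    unfolding * using assms(2) by (simp add: sum.If_cases)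
  also have "I \<inter> {i. g i \<noteq> 0} = {i. g i \<noteq> 0}"
    using assms(1) by (auto simp: sparse_signs_def)
  finally show ?thesis
    using assms(1) by (simp add: sparse_signs_def)
qed

lemma sparse_signs_square:
  "g \<in> sparse_signs I m \<Longrightarrow> g i * g i = \<bar>g i\<bar>"
  using sparse_signs_values[of g I m i] by auto

lemma sparse_signs_negate:
  assumes "g \<in> sparse_signs I m"
  shows "g(j := - g j) \<in> sparse_signs I m"
proof -
  have "{i. (g(j := - g j)) i \<noteq> 0} = {i. g i \<noteq> 0}"
    by auto
  moreover have "(g(j := - g j)) i \<in> {- 1, 0, 1}" for i
    using sparse_signs_values[OF assms, of i] by auto
  ultimately show ?thesis
    using assms unfolding sparse_signs_def by (simp del: fun_upd_apply)
qed

lemma sparse_signs_transpose: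
  assumes "g \<in> sparse_signs I m" "j \<in> I" "k \<in> I"
  shows "g \<circ> Transposition.transpose j k \<in> sparse_signs I m"
proof -
  let ?t = "Transposition.transpose j k"
  have eq: "{i. (g \<circ> ?t) i \<noteq> 0} = ?t ` {i. g i \<noteq> 0}"
    by (auto simp: image_iff) (metis transpose_involutory)
  have "card (?t ` {i. g i \<noteq> 0}) = card {i. g i \<noteq> 0}"
    by (rule card_image) (rule inj_on_transpose)
  moreover have "?t ` {i. g i \<noteq> 0} \<subseteq> I"
    using assms unfolding sparse_signs_def Transposition.transpose_def by auto
  ultimately show ?thesis
    using assms(1) unfolding sparse_signs_def mem_Collect_eq eq by auto
qed

text \<open>
  This replaces all arguments with conditional expectations: an involution that the queries
  cannot detect plays the part of conditioning on what has been read.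
\<close>

lemma sum_antisymmetric_involution_eq_0:
  fixes F :: "'a \<Rightarrow> real"
  assumes "\<And>g. g \<in> G \<Longrightarrow> \<phi> g \<in> G" "\<And>g. g \<in> G \<Longrightarrow> \<phi> (\<phi> g) = g"
    and "\<And>g. g \<in> G \<Longrightarrow> F (\<phi> g) = - F g"
  shows "sum F G = 0"
proof -
  have "sum F G = (\<Sum>g\<in>G. - F g)"
    by (rule sum.reindex_bij_witness[of _ \<phi> \<phi>]) (use assms in auto)
  then show ?thesis
    by (simp add: sum_negf)
qed

text \<open>
  A deterministic decision tree that reads values of a hidden function \<open>g\<close>. Instead of
  representing the tree, the locale takes the \<open>k\<close>-th query as a function of all of \<open>g\<close> and
  demands that it depend on \<open>g\<close> only through the answers to the earlier queries. Queries may
  repeat, so fewer than \<open>i\<close> indices may have been seen after \<open>i\<close> queries.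
\<close>

locale adaptive_queries =
  fixes I :: "'a set" and n :: nat and query :: "nat \<Rightarrow> ('a \<Rightarrow> real) \<Rightarrow> 'a"
  assumes finite_index: "finite I"
    and query_in_index: "\<And>k g. k < n \<Longrightarrow> query k g \<in> I"
    and query_adapted:
      "\<And>k g g'. k < n \<Longrightarrow> (\<And>l. l < k \<Longrightarrow> g' (query l g) = g (query l g)) \<Longrightarrow> query k g' = query k g"
begin

definition seen :: "nat \<Rightarrow> ('a \<Rightarrow> real) \<Rightarrow> 'a set" where
  "seen i g = (\<lambda>k. query k g) ` {..<i}"

definition hidden :: "nat \<Rightarrow> ('a \<Rightarrow> real) \<Rightarrow> 'a set" where
  "hidden i g = I - seen i g"

lemma query_cong:
  assumes "k \<le> i" "k < n" "\<And>x. x \<in> seen i g \<Longrightarrow> g' x = g x"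
  shows "query k g' = query k g"
  by (rule query_adapted) (use assms in \<open>auto simp: seen_def\<close>)

lemma seen_cong:
  assumes "i \<le> n" "\<And>x. x \<in> seen i g \<Longrightarrow> g' x = g x"
  shows "seen i g' = seen i g"
  using query_cong[of _ i g g'] assms by (auto simp: seen_def)

lemma finite_hidden: "finite (hidden i g)"
  using finite_index by (simp add: hidden_def)

lemma card_hidden_ge:
  assumes "i \<le> n"
  shows "card I - i \<le> card (hidden i g)"
proof -
  have "card (seen i g) \<le> i"
    using card_image_le[of "{..<i}" "\<lambda>k. query k g"] by (simp add: seen_def)
  moreover have "card I - card (seen i g) \<le> card (hidden i g)"
    unfolding hidden_def by (rule diff_card_le_card_Diff) (simp add: seen_def)
  ultimately show ?thesis
    by linarith
qed

text \<open>
  The sign at an index that is never read is independent of everything else. Flipping it is an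
  involution of the patterns, because the flip leaves the whole run unchanged, in particular
  whether \<open>j\<close> is hidden.
\<close>

lemma sum_hidden_sign_eq_0:
  assumes "\<And>g g'. g \<in> sparse_signs I m \<Longrightarrow> (\<And>x. x \<noteq> j \<Longrightarrow> g' x = g x) \<Longrightarrow> j \<in> hidden n g \<Longrightarrow> h g' = h g"
  shows "(\<Sum>g\<in>sparse_signs I m. if j \<in> hidden n g then g j * h g else 0) = 0"
proof (rule sum_antisymmetric_involution_eq_0)
  let ?flip = "\<lambda>g. if j \<in> hidden n g then g(j := - g j) else g"
  fix g assume g: "g \<in> sparse_signs I m"
  show "?flip g \<in> sparse_signs I m"
    using g by (simp add: sparse_signs_negate)
  have hid: "hidden n (?flip g) = hidden n g"
  proof (cases "j \<in> hidden n g")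
    case True
    then have "seen n (g(j := - g j)) = seen n g"
      by (intro seen_cong) (auto simp: hidden_def)
    with True show ?thesis
      by (simp add: hidden_def)
  qed simp
  show "?flip (?flip g) = g"
    using hid by auto
  show "(if j \<in> hidden n (?flip g) then ?flip g j * h (?flip g) else 0)
      = - (if j \<in> hidden n g then g j * h g else 0)"
    using hid assms[OF g, of "g(j := - g j)"] by auto
qed

text \<open>
  Any guess \<open>a\<close> for \<open>\<Sum>g\<close> that is based on the answers has a mean square error at least
  the variance of the hidden part of the sum. Split the error into \<open>T + U\<close>, with \<open>U\<close> the sum over the hidden
  indices; then \<open>T\<^sup>2\<close> is dropped, and in \<open>2TU + U\<^sup>2\<close> only the squares \<open>(g j)\<^sup>2 = \<bar>g j\<bar>\<close> survive
  the averaging, since each other term contains a hidden sign to the first power.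
\<close>

lemma sum_square_error_ge_hidden_support:
  assumes "\<And>g g'. (\<And>x. x \<in> seen n g \<Longrightarrow> g' x = g x) \<Longrightarrow> a g' = a g"
  shows "(\<Sum>g\<in>sparse_signs I m. \<Sum>j\<in>hidden n g. \<bar>g j\<bar>)
    \<le> (\<Sum>g\<in>sparse_signs I m. ((\<Sum>j\<in>I. g j) - a g)\<^sup>2)"
proof -
  define T where "T g = (\<Sum>j\<in>I \<inter> seen n g. g j) - a g" for g
  \<comment> \<open>The cofactor of the hidden sign \<open>g j\<close> in \<open>2TU + U\<^sup>2 - \<Sum>\<bar>g j\<bar>\<close>; it does not involve \<open>g j\<close>.\<close>
  define h where "h j g = 2 * T g + (\<Sum>k\<in>hidden n g - {j}. g k)" for j g
  have T_cong: "T g' = T g" if "\<And>x. x \<in> seen n g \<Longrightarrow> g' x = g x" for g g'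
    using that seen_cong[of n g g'] assms[of g g'] by (auto simp: T_def)
  have h_cong: "h j g' = h j g" if *: "\<And>x. x \<noteq> j \<Longrightarrow> g' x = g x" and "j \<in> hidden n g" for j g g'
  proof -
    have **: "g' x = g x" if "x \<in> seen n g" for x
      using that \<open>j \<in> hidden n g\<close> *[of x] unfolding hidden_def by blast
    have "hidden n g' = hidden n g"
      using seen_cong[of n g g'] ** by (simp add: hidden_def)
    then show ?thesis
      using T_cong[of g g'] ** * by (auto simp: h_def)
  qed
  have pointwise: "(\<Sum>j\<in>hidden n g. \<bar>g j\<bar>) + (\<Sum>j\<in>I. if j \<in> hidden n g then g j * h j g else 0)
      \<le> ((\<Sum>j\<in>I. g j) - a g)\<^sup>2" if g: "g \<in> sparse_signs I m" for g
  proof -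
    define U where "U = (\<Sum>j\<in>hidden n g. g j)"
    have "(\<Sum>j\<in>I. g j) = (\<Sum>j\<in>I \<inter> seen n g. g j) + U"
      unfolding U_def hidden_def using sum.Int_Diff[OF finite_index] by blast
    then have TU: "(\<Sum>j\<in>I. g j) - a g = T g + U"
      by (simp add: T_def)
    have "(\<Sum>j\<in>I. if j \<in> hidden n g then g j * h j g else 0) = (\<Sum>j\<in>hidden n g. g j * h j g)"
      by (rule sum.mono_neutral_cong_right) (auto simp: hidden_def finite_index)
    also have "\<dots> = (\<Sum>j\<in>hidden n g. 2 * T g * g j + U * g j - \<bar>g j\<bar>)"
    proof (rule sum.cong)
      fix j assume j: "j \<in> hidden n g"
      have rest: "(\<Sum>k\<in>hidden n g - {j}. g k) = U - g j"
        unfolding U_def by (simp add: sum_diff1 finite_hidden j)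
      then show "g j * h j g = 2 * T g * g j + U * g j - \<bar>g j\<bar>"
        unfolding h_def rest using sparse_signs_square[OF g, of j] by (simp add: algebra_simps)
    qed simp
    also have "\<dots> = 2 * T g * U + U * U - (\<Sum>j\<in>hidden n g. \<bar>g j\<bar>)"
      by (simp add: sum.distrib sum_subtractf U_def flip: sum_distrib_left)
    finally show ?thesis
      unfolding TU by (simp add: power2_eq_square algebra_simps)
  qed
  have "(\<Sum>g\<in>sparse_signs I m. \<Sum>j\<in>I. if j \<in> hidden n g then g j * h j g else 0) = 0"
    by (subst sum.swap) (intro sum.neutral ballI sum_hidden_sign_eq_0 h_cong, auto)
  then show ?thesis
    using sum_mono[OF pointwise, of "sparse_signs I m" "\<lambda>g. g"] by (simp add: sum.distrib)
qed

text \<open>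
  For \<open>g\<close> with values in \<open>{-1, 0, 1}\<close>, this is the proportion of nonzero values among the hidden
  indices. It is the conditional probability that the next fresh query hits the support.
\<close>

definition hidden_density :: "nat \<Rightarrow> ('a \<Rightarrow> real) \<Rightarrow> real" where
  "hidden_density i g = (\<Sum>j\<in>hidden i g. \<bar>g j\<bar>) / card (hidden i g)"

text \<open>
  Given the answers so far, the next fresh index is as likely to lie in the support as any other
  hidden index \<open>j\<close>: exchanging the values at the two is an involution that changes neither the
  answers nor the choice of the next query. The weight \<open>r\<close> may depend on the number of hidden
  indices, which varies with \<open>g\<close> because queries may repeat.
\<close>

lemma sum_swap_query_eq_0:
  assumes "i < n" "j \<in> I"
  shows "(\<Sum>g\<in>sparse_signs I m. if j \<in> hidden i g \<and> query i g \<in> hidden i g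
      then r (card (hidden i g)) * (\<bar>g j\<bar> - \<bar>g (query i g)\<bar>) else 0) = (0::real)"
proof (rule sum_antisymmetric_involution_eq_0)
  let ?c = "\<lambda>g. j \<in> hidden i g \<and> query i g \<in> hidden i g"
  let ?swap = "\<lambda>g. if ?c g then g \<circ> Transposition.transpose j (query i g) else g"
  fix g assume g: "g \<in> sparse_signs I m"
  show "?swap g \<in> sparse_signs I m"
    using g assms query_in_index by (simp add: sparse_signs_transpose)
  have agree: "?swap g x = g x" if "x \<in> seen i g" for x
    using that unfolding hidden_def Transposition.transpose_def by auto
  have hid: "hidden i (?swap g) = hidden i g"
    using seen_cong[of i g "?swap g"] agree assms(1) unfolding hidden_def by simp
  have qry: "query i (?swap g) = query i g"
    using query_cong[of i i g "?swap g"] agree assms(1) by simp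
  show "?swap (?swap g) = g"
    unfolding hid qry by (simp add: comp_assoc)
  show "(if ?c (?swap g) then r (card (hidden i (?swap g))) * (\<bar>?swap g j\<bar> - \<bar>?swap g (query i (?swap g))\<bar>) else 0)
      = - (if ?c g then r (card (hidden i g)) * (\<bar>g j\<bar> - \<bar>g (query i g)\<bar>) else 0)"
    unfolding hid qry by (simp add: algebra_simps)
qed

text \<open>
  The martingale property. A fresh query removes one hidden index, which changes the density by a
  weighted sum of the differences between the hidden values and the value just read.
\<close>

lemma sum_hidden_density_Suc:
  assumes "i < n" "n < card I"
  shows "(\<Sum>g\<in>sparse_signs I m. hidden_density (Suc i) g) = (\<Sum>g\<in>sparse_signs I m. hidden_density i g)"
proof -
  \<comment> \<open>From \<open>(J - v)/(K - 1) - J/K = (J - K v) / (K (K - 1))\<close>.\<close>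
  define r :: "nat \<Rightarrow> real" where "r K = 1 / (real K * (real K - 1))" for K
  have pointwise: "hidden_density (Suc i) g - hidden_density i g
      = (\<Sum>j\<in>I. if j \<in> hidden i g \<and> query i g \<in> hidden i g
          then r (card (hidden i g)) * (\<bar>g j\<bar> - \<bar>g (query i g)\<bar>) else 0)" for g
  proof (cases "query i g \<in> hidden i g")
    case False
    then have "query i g \<in> seen i g"
      using query_in_index[OF assms(1)] by (simp add: hidden_def)
    then have "hidden (Suc i) g = hidden i g"
      by (auto simp: hidden_def seen_def lessThan_Suc)
    with False show ?thesis
      by (simp add: hidden_density_def)
  next
    case True
    define K where "K = card (hidden i g)"
    define J where "J = (\<Sum>j\<in>hidden i g. \<bar>g j\<bar>)"
    define v where "v = \<bar>g (query i g)\<bar>"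
    \<comment> \<open>Strictly more than \<open>n\<close> indices are needed, lest the query empty the hidden set.\<close>
    have K: "2 \<le> K"
      using card_hidden_ge[of i g] assms by (simp add: K_def)
    have "hidden (Suc i) g = hidden i g - {query i g}"
      by (auto simp: hidden_def seen_def lessThan_Suc)
    then have new: "hidden_density (Suc i) g = (J - v) / (real K - 1)"
      using True K by (simp add: hidden_density_def sum_diff1 finite_hidden J_def v_def K_def of_nat_diff)
    have old: "hidden_density i g = J / real K"
      by (simp add: hidden_density_def J_def K_def)
    have "hidden_density (Suc i) g - hidden_density i g = r K * (J - real K * v)"
      unfolding new old r_def using K by (simp add: field_simps)
    also have "J - real K * v = (\<Sum>j\<in>hidden i g. \<bar>g j\<bar> - v)"
      by (simp add: sum_subtractf J_def K_def)
    also have "r K * \<dots> = (\<Sum>j\<in>hidden i g. r K * (\<bar>g j\<bar> - v))"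
      by (simp add: sum_distrib_left)
    also have "\<dots> = (\<Sum>j\<in>I. if j \<in> hidden i g \<and> query i g \<in> hidden i g then r K * (\<bar>g j\<bar> - v) else 0)"
      using True by (intro sum.mono_neutral_cong_left) (auto simp: hidden_def finite_index)
    finally show ?thesis
      unfolding K_def v_def .
  qed
  have "(\<Sum>g\<in>sparse_signs I m. hidden_density (Suc i) g - hidden_density i g) = 0"
    unfolding pointwise
    by (subst sum.swap) (intro sum.neutral ballI sum_swap_query_eq_0 assms(1))
  then show ?thesis
    by (simp add: sum_subtractf)
qed

lemma sum_hidden_density:
  assumes "i \<le> n" "n < card I"
  shows "(\<Sum>g\<in>sparse_signs I m. hidden_density i g) = card (sparse_signs I m) * (real m / card I)"
  using assms(1)
proof (induction i)
  case 0
  have "hidden_density 0 g = real m / card I" if "g \<in> sparse_signs I m" for g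
    using sparse_signs_abs_sum[OF that finite_index] by (simp add: hidden_density_def hidden_def seen_def)
  then show ?case
    by simp
next
  case (Suc i)
  then show ?case
    using sum_hidden_density_Suc[of i m] assms(2) by simp
qed

text \<open>
  The mean density stays at its initial value \<open>m / card I\<close>, and at least \<open>card I - n\<close> indices
  remain hidden in every run.
\<close>

lemma sum_hidden_support_ge:
  assumes "n < card I"
  shows "card (sparse_signs I m) * (real m * (real (card I) - n) / card I)
    \<le> (\<Sum>g\<in>sparse_signs I m. \<Sum>j\<in>hidden n g. \<bar>g j\<bar>)"
proof -
  have "(real (card I) - n) * hidden_density n g \<le> (\<Sum>j\<in>hidden n g. \<bar>g j\<bar>)" for g
  proof -
    have K: "real (card I) - n \<le> card (hidden n g)" "0 < card (hidden n g)"
      using card_hidden_ge[of n g] assms by linarith+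
    have "(real (card I) - n) * hidden_density n g \<le> card (hidden n g) * hidden_density n g"
      by (intro mult_right_mono K) (simp add: hidden_density_def sum_nonneg)
    then show ?thesis
      using K by (simp add: hidden_density_def)
  qed
  then have "(\<Sum>g\<in>sparse_signs I m. (real (card I) - n) * hidden_density n g)
      \<le> (\<Sum>g\<in>sparse_signs I m. \<Sum>j\<in>hidden n g. \<bar>g j\<bar>)"
    by (rule sum_mono)
  moreover have "(\<Sum>g\<in>sparse_signs I m. (real (card I) - n) * hidden_density n g)
      = card (sparse_signs I m) * (real m * (real (card I) - n) / card I)"
    using sum_hidden_density[of n m] assms by (simp flip: sum_distrib_left)
  ultimately show ?thesis
    by simp
qed

end

section \<open>Integrands and densities that are constant on the cells of a partition\<close>

definition step_function :: "'a set set \<Rightarrow> ('a set \<Rightarrow> real) \<Rightarrow> 'a \<Rightarrow> real" where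
  "step_function \<A> g x = (\<Sum>A\<in>\<A>. g A * indicator A x)"

lemma step_function_eq:
  assumes "finite \<A>" "disjoint \<A>" "A \<in> \<A>" "x \<in> A"
  shows "step_function \<A> g x = g A"
proof -
  have "step_function \<A> g x = (\<Sum>B\<in>\<A>. if B = A then g A else 0)"
    unfolding step_function_def
    by (rule sum.cong) (use assms in \<open>auto simp: indicator_def dest: disjointD\<close>)
  then show ?thesis
    using assms by simp
qed

lemma step_function_measurable:
  assumes "\<And>A. A \<in> \<A> \<Longrightarrow> A \<in> sets M"
  shows "step_function \<A> g \<in> borel_measurable M"
  unfolding step_function_def
  by (intro borel_measurable_sum borel_measurable_times borel_measurable_const
      borel_measurable_indicator assms)

lemma integral_step_function:
  assumes "finite_measure M" "\<And>A. A \<in> \<A> \<Longrightarrow> A \<in> sets M"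
  shows "(\<integral>x. step_function \<A> g x \<partial>M) = (\<Sum>A\<in>\<A>. g A * measure M A)"
proof -
  interpret finite_measure M by fact
  have "(\<integral>x. step_function \<A> g x \<partial>M) = (\<Sum>A\<in>\<A>. \<integral>x. g A * indicator A x \<partial>M)"
    unfolding step_function_def
    by (intro Bochner_Integration.integral_sum integrable_mult_right integrable_real_indicator)
      (auto simp: assms less_top[symmetric])
  also have "\<dots> = (\<Sum>A\<in>\<A>. g A * measure M A)"
    using assms(2) by (intro sum.cong) (auto dest: sets.sets_into_space simp: Int_absorb2)
  finally show ?thesis .
qed

definition cell_of :: "'a set set \<Rightarrow> 'a \<Rightarrow> 'a set" where
  "cell_of \<A> x = (THE A. A \<in> \<A> \<and> x \<in> A)"

lemma cell_of:
  assumes "partition_on X \<A>" "x \<in> X"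
  shows "cell_of \<A> x \<in> \<A>" "x \<in> cell_of \<A> x"
proof -
  have "\<exists>!A. A \<in> \<A> \<and> x \<in> A"
  proof (rule ex_ex1I)
    show "\<exists>A. A \<in> \<A> \<and> x \<in> A"
      using assms(2) partition_onD1[OF assms(1)] by blast
  next
    fix A B assume "A \<in> \<A> \<and> x \<in> A" "B \<in> \<A> \<and> x \<in> B"
    then show "A = B"
      using disjointD[OF partition_onD2[OF assms(1)], of A B] by blast
  qed
  from theI'[OF this] show "cell_of \<A> x \<in> \<A>" "x \<in> cell_of \<A> x"
    by (auto simp: cell_of_def)
qed

text \<open>
  For \<open>g\<close> with values in \<open>{-1, 0, 1}\<close>, the density is \<open>C\<close> on the support of \<open>g\<close> and \<open>1\<close>
  elsewhere. Thus the density carries no information about the signs.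
\<close>

definition sign_density :: "real \<Rightarrow> ('b \<Rightarrow> real) \<Rightarrow> 'b \<Rightarrow> real" where
  "sign_density C g A = 1 + (C - 1) * \<bar>g A\<bar>"

lemma step_function_input_class:
  assumes part: "partition_on (space M) \<A>" and fin: "finite \<A>"
    and sets: "\<And>A. A \<in> \<A> \<Longrightarrow> A \<in> sets M"
    and C: "1 \<le> C" and g: "g \<in> sparse_signs \<A> m"
  shows "(step_function \<A> g, step_function \<A> (sign_density C g)) \<in> input_class M C"
proof -
  note val = sparse_signs_values[OF g]
  have eq: "\<exists>A. \<forall>h. step_function \<A> h x = h A" if "x \<in> space M" for x
    using cell_of[OF part that] step_function_eq[OF fin] part by (auto simp: partition_on_def)
  have "sign_density C g A \<in> {1, C}" for A
    using val[of A] by (auto simp: sign_density_def)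
  then have dens: "step_function \<A> (sign_density C g) x \<in> {1, C}" if "x \<in> space M" for x
    using eq[OF that] by metis
  have "\<bar>step_function \<A> g x\<bar> \<le> 1" if x: "x \<in> space M" for x
  proof -
    obtain A where "step_function \<A> g x = g A"
      using eq[OF x] by blast
    then show ?thesis
      using val[of A] by auto
  qed
  moreover have "0 < step_function \<A> (sign_density C g) x" if "x \<in> space M" for x
    using dens[OF that] C by auto
  moreover have "step_function \<A> (sign_density C g) x / step_function \<A> (sign_density C g) y \<le> C"
    if "x \<in> space M" "y \<in> space M" for x y
    using dens[OF that(1)] dens[OF that(2)] C mult_mono[OF C C] by (auto simp: field_simps)
  ultimately show ?thesis
    using sets by (simp add: input_class_def step_function_measurable)
qed

text \<open>
  The size of the support is fixed so that the denominator \<open>\<integral>\<rho>\<close> is the same for all patterns,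
  which makes the solution linear in \<open>g\<close>.
\<close>

lemma solution_step_function:
  fixes C :: real
  assumes M: "finite_measure M" and part: "partition_on (space M) \<A>" and fin: "finite \<A>"
    and sets: "\<And>A. A \<in> \<A> \<Longrightarrow> A \<in> sets M"
    and eqm: "\<And>A. A \<in> \<A> \<Longrightarrow> measure M A = q" and q: "q \<noteq> 0"
    and g: "g \<in> sparse_signs \<A> m"
  shows "solution M (step_function \<A> g) (step_function \<A> (sign_density C g))
    = C / (card \<A> + (C - 1) * m) * (\<Sum>A\<in>\<A>. g A)"
proof -
  have prod: "g A * sign_density C g A = C * g A" for A
    using sparse_signs_values[OF g, of A] by (auto simp: sign_density_def)
  have "(\<integral>x. step_function \<A> g x * step_function \<A> (sign_density C g) x \<partial>M)
      = (\<integral>x. step_function \<A> (\<lambda>A. C * g A) x \<partial>M)"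
  proof (rule Bochner_Integration.integral_cong)
    fix x assume "x \<in> space M"
    note step = step_function_eq[OF fin partition_onD2[OF part] cell_of[OF part this]]
    show "step_function \<A> g x * step_function \<A> (sign_density C g) x
        = step_function \<A> (\<lambda>A. C * g A) x"
      unfolding step by (rule prod)
  qed simp
  also have "\<dots> = q * (C * (\<Sum>A\<in>\<A>. g A))"
    by (simp add: integral_step_function[OF M sets] eqm sum_distrib_left mult_ac)
  finally have num: "(\<integral>x. step_function \<A> g x * step_function \<A> (sign_density C g) x \<partial>M)
      = q * (C * (\<Sum>A\<in>\<A>. g A))" .
  have "(\<integral>x. step_function \<A> (sign_density C g) x \<partial>M) = (\<Sum>A\<in>\<A>. q * sign_density C g A)"
    by (simp add: integral_step_function[OF M sets] eqm mult.commute)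
  also have "\<dots> = q * (card \<A> + (C - 1) * (\<Sum>A\<in>\<A>. \<bar>g A\<bar>))"
    by (simp add: sign_density_def sum.distrib flip: sum_distrib_left)
  also have "(\<Sum>A\<in>\<A>. \<bar>g A\<bar>) = m"
    by (rule sparse_signs_abs_sum[OF g fin])
  finally show ?thesis
    using num q by (simp add: solution_def)
qed

section \<open>Monte Carlo methods as adaptive queries\<close>

lemma length_mc_nodes: "length (mc_nodes S f \<rho> w i) = i"
  by (induction i) (simp_all add: Let_def)

lemma mc_nodes_in_space:
  assumes "is_monte_carlo_method M F n S" "w \<in> space (rng S)" "i \<le> n"
  shows "set (mc_nodes S f \<rho> w i) \<subseteq> space M"
  using assms(3)
proof (induction i)
  case (Suc i)
  then have i: "Suc i \<in> {1..n}"
    by simp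
  then have "noise S (Suc i) w \<in> space (noise_space S (Suc i))"
    using assms(1,2) unfolding is_monte_carlo_method_def by (blast dest: measurable_space)
  then have "node S (Suc i) ys zs (noise S (Suc i) w) \<in> space M"
    if "length ys = i" "length zs = i" for ys zs
    using assms(1) i that unfolding is_monte_carlo_method_def by simp
  then show ?case
    using Suc by (simp add: Let_def length_mc_nodes)
qed simp

lemma mc_nodes_nth:
  "k < i \<Longrightarrow> mc_nodes S f \<rho> w i ! k = mc_nodes S f \<rho> w (Suc k) ! k"
proof (induction i)
  case (Suc i)
  then show ?case
    by (cases "k = i") (auto simp: Let_def nth_append length_mc_nodes)
qed simp

text \<open>
  Equal values at the first \<open>i\<close> nodes force the next node to be equal too. This is where
  adaptivity is limited: a run depends on the input only through the values it computes.
\<close>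

lemma mc_nodes_cong:
  assumes "\<And>x. x \<in> set (mc_nodes S f \<rho> w i) \<Longrightarrow> f' x = f x \<and> \<rho>' x = \<rho> x"
  shows "mc_nodes S f' \<rho>' w i = mc_nodes S f \<rho> w i \<and>
    mc_nodes S f' \<rho>' w (Suc i) = mc_nodes S f \<rho> w (Suc i)"
  using assms
proof (induction i)
  case (Suc i)
  have "f' x = f x \<and> \<rho>' x = \<rho> x" if "x \<in> set (mc_nodes S f \<rho> w i)" for x
    using Suc.prems[of x] that by (simp add: Let_def)
  from Suc.IH[OF this] have eq: "mc_nodes S f' \<rho>' w (Suc i) = mc_nodes S f \<rho> w (Suc i)"
    by blast
  have maps: "map f' (mc_nodes S f \<rho> w (Suc i)) = map f (mc_nodes S f \<rho> w (Suc i))"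
    "map \<rho>' (mc_nodes S f \<rho> w (Suc i)) = map \<rho> (mc_nodes S f \<rho> w (Suc i))"
    using Suc.prems by (simp_all del: mc_nodes.simps)
  show ?case
    by (intro conjI eq) (simp only: mc_nodes.simps(2)[of _ _ _ _ "Suc i"] Let_def eq maps)
qed simp

lemma mc_output_cong:
  assumes "\<And>x. x \<in> set (mc_nodes S f \<rho> w n) \<Longrightarrow> f' x = f x \<and> \<rho>' x = \<rho> x"
  shows "mc_output S n f' \<rho>' w = mc_output S n f \<rho> w"
proof -
  have nodes: "mc_nodes S f' \<rho>' w n = mc_nodes S f \<rho> w n"
    using mc_nodes_cong[of S f \<rho> w n f' \<rho>'] assms by blast
  have maps: "map f' (mc_nodes S f \<rho> w n) = map f (mc_nodes S f \<rho> w n)"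
    "map \<rho>' (mc_nodes S f \<rho> w n) = map \<rho> (mc_nodes S f \<rho> w n)"
    using assms by simp_all
  show ?thesis
    by (simp only: mc_output_def Let_def nodes maps)
qed

text \<open>
  For a fixed outcome \<open>w\<close>, reading \<open>f\<close> and \<open>\<rho>\<close> at a node amounts to reading \<open>g\<close> at the cell that
  contains the node, so the run is an adaptive sequence of queries to \<open>g\<close>, and the output divided
  by \<open>\<kappa>\<close> is a guess for \<open>\<Sum>g\<close>.
\<close>

lemma sum_square_error_ge:
  fixes S :: "('a, 'w, 'r) monte_carlo" and C :: real
  assumes M: "finite_measure M" and C: "C > 0"
    and part: "partition_on (space M) \<A>" and fin: "finite \<A>"
    and sets: "\<And>A. A \<in> \<A> \<Longrightarrow> A \<in> sets M"
    and eqm: "\<And>A. A \<in> \<A> \<Longrightarrow> measure M A = q" and q: "q \<noteq> 0"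
    and S: "is_monte_carlo_method M F n S" and w: "w \<in> space (rng S)"
    and n: "n < card \<A>" and pos: "0 < card \<A> + (C - 1) * m"
  shows "card (sparse_signs \<A> m) *
      ((C / (card \<A> + (C - 1) * m))\<^sup>2 * (real m * (real (card \<A>) - n) / card \<A>))
    \<le> (\<Sum>g\<in>sparse_signs \<A> m.
        \<bar>solution M (step_function \<A> g) (step_function \<A> (sign_density C g))
          - mc_output S n (step_function \<A> g) (step_function \<A> (sign_density C g)) w\<bar>\<^sup>2)"
proof -
  define nodes where "nodes g = mc_nodes S (step_function \<A> g) (step_function \<A> (sign_density C g)) w" for g
  define query where "query k g = cell_of \<A> (nodes g (Suc k) ! k)" for k g
  define out where "out g = mc_output S n (step_function \<A> g) (step_function \<A> (sign_density C g)) w" for g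
  define \<kappa> where "\<kappa> = C / (card \<A> + (C - 1) * m)"
  have space: "set (nodes g i) \<subseteq> space M" if "i \<le> n" for g i
    unfolding nodes_def using mc_nodes_in_space[OF S w that] .
  have len: "length (nodes g i) = i" for g i
    by (simp add: nodes_def length_mc_nodes)
  have agree: "step_function \<A> g' x = step_function \<A> g x \<and>
      step_function \<A> (sign_density C g') x = step_function \<A> (sign_density C g) x"
    if i: "i \<le> n" and x: "x \<in> set (nodes g i)"
      and eq: "\<And>l. l < i \<Longrightarrow> g' (query l g) = g (query l g)" for g g' i x
  proof -
    obtain l where l: "l < i" "x = nodes g i ! l"
      using x len by (metis in_set_conv_nth)
    then have cell: "cell_of \<A> x = query l g"
      unfolding l(2) query_def nodes_def by (simp only: mc_nodes_nth[OF l(1)])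
    have "x \<in> space M"
      using x space[OF i] by blast
    note c = cell_of[OF part this]
    have "step_function \<A> h x = h (query l g)" for h :: "'a set \<Rightarrow> real"
      using step_function_eq[OF fin _ c] part cell by (simp add: partition_on_def)
    then show ?thesis
      using eq[OF l(1)] by (simp add: sign_density_def)
  qed
  interpret adaptive_queries \<A> n query
  proof
    fix k g assume k: "k < n"
    have "nodes g (Suc k) ! k \<in> set (nodes g (Suc k))"
      by (simp add: len)
    then have "nodes g (Suc k) ! k \<in> space M"
      using space[of "Suc k" g] k by auto
    then show "query k g \<in> \<A>"
      unfolding query_def by (rule cell_of(1)[OF part])
  next
    fix k g g' assume k: "k < n" and eq: "\<And>l. l < k \<Longrightarrow> g' (query l g) = g (query l g)"
    have same: "step_function \<A> g' x = step_function \<A> g x \<and>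
        step_function \<A> (sign_density C g') x = step_function \<A> (sign_density C g) x"
      if "x \<in> set (nodes g k)" for x
      using k by (intro agree[OF _ that eq]) simp_all
    have "nodes g' (Suc k) = nodes g (Suc k)"
      unfolding nodes_def by (rule conjunct2[OF mc_nodes_cong]) (rule same, simp only: nodes_def)
    then show "query k g' = query k g"
      by (simp add: query_def)
  qed (fact fin)
  have out_cong: "out g' = out g" if "\<And>x. x \<in> seen n g \<Longrightarrow> g' x = g x" for g g'
    unfolding out_def
  proof (rule mc_output_cong)
    fix x assume "x \<in> set (mc_nodes S (step_function \<A> g) (step_function \<A> (sign_density C g)) w n)"
    then have x: "x \<in> set (nodes g n)"
      by (simp only: nodes_def)
    show "step_function \<A> g' x = step_function \<A> g x \<and>
        step_function \<A> (sign_density C g') x = step_function \<A> (sign_density C g) x"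
      by (rule agree[OF order_refl x]) (rule that, simp add: seen_def)
  qed
  have "(\<Sum>g\<in>sparse_signs \<A> m. \<Sum>j\<in>hidden n g. \<bar>g j\<bar>)
      \<le> (\<Sum>g\<in>sparse_signs \<A> m. ((\<Sum>A\<in>\<A>. g A) - out g / \<kappa>)\<^sup>2)"
  proof (rule sum_square_error_ge_hidden_support[where a = "\<lambda>g. out g / \<kappa>"])
    fix g g' :: "'a set \<Rightarrow> real" assume "\<And>x. x \<in> seen n g \<Longrightarrow> g' x = g x"
    then have "out g' = out g"
      by (rule out_cong)
    then show "out g' / \<kappa> = out g / \<kappa>"
      by (simp only:)
  qed
  with sum_hidden_support_ge[OF n, of m]
  have "card (sparse_signs \<A> m) * (real m * (real (card \<A>) - n) / card \<A>)
      \<le> (\<Sum>g\<in>sparse_signs \<A> m. ((\<Sum>A\<in>\<A>. g A) - out g / \<kappa>)\<^sup>2)"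
    by linarith
  then have "\<kappa>\<^sup>2 * (card (sparse_signs \<A> m) * (real m * (real (card \<A>) - n) / card \<A>))
      \<le> \<kappa>\<^sup>2 * (\<Sum>g\<in>sparse_signs \<A> m. ((\<Sum>A\<in>\<A>. g A) - out g / \<kappa>)\<^sup>2)"
    by (rule mult_left_mono) simp
  also have "\<dots> = (\<Sum>g\<in>sparse_signs \<A> m.
      \<bar>solution M (step_function \<A> g) (step_function \<A> (sign_density C g)) - out g\<bar>\<^sup>2)"
    unfolding sum_distrib_left
  proof (rule sum.cong)
    fix g assume g: "g \<in> sparse_signs \<A> m"
    have "\<kappa> \<noteq> 0"
      using C pos by (simp add: \<kappa>_def)
    then have scale: "\<kappa> * ((\<Sum>A\<in>\<A>. g A) - out g / \<kappa>) = \<kappa> * (\<Sum>A\<in>\<A>. g A) - out g"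
      by (simp add: right_diff_distrib)
    have "solution M (step_function \<A> g) (step_function \<A> (sign_density C g)) = \<kappa> * (\<Sum>A\<in>\<A>. g A)"
      unfolding \<kappa>_def by (rule solution_step_function[OF M part fin sets eqm q g])
    then show "\<kappa>\<^sup>2 * ((\<Sum>A\<in>\<A>. g A) - out g / \<kappa>)\<^sup>2
        = \<bar>solution M (step_function \<A> g) (step_function \<A> (sign_density C g)) - out g\<bar>\<^sup>2"
      by (simp only: power2_abs scale flip: power_mult_distrib)
  qed simp
  finally show ?thesis
    unfolding \<kappa>_def out_def by (simp only: mult_ac)
qed

section \<open>From the average over the inputs to the worst case\<close>

lemma exists_nn_integral_ge_average:
  assumes "prob_space N" "finite G" "G \<noteq> {}"
    and "\<And>g. g \<in> G \<Longrightarrow> \<phi> g \<in> borel_measurable N"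
    and "\<And>w. w \<in> space N \<Longrightarrow> of_nat (card G) * K \<le> (\<Sum>g\<in>G. \<phi> g w)"
  shows "\<exists>g\<in>G. (K::ennreal) \<le> (\<integral>\<^sup>+w. \<phi> g w \<partial>N)"
proof -
  interpret prob_space N by fact
  define B where "B = Max ((\<lambda>g. \<integral>\<^sup>+w. \<phi> g w \<partial>N) ` G)"
  have "of_nat (card G) * K = (\<integral>\<^sup>+w. of_nat (card G) * K \<partial>N)"
    by (simp add: emeasure_space_1)
  also have "\<dots> \<le> (\<integral>\<^sup>+w. (\<Sum>g\<in>G. \<phi> g w) \<partial>N)"
    by (rule nn_integral_mono) (rule assms(5))
  also have "\<dots> = (\<Sum>g\<in>G. \<integral>\<^sup>+w. \<phi> g w \<partial>N)"
    by (rule nn_integral_sum) (rule assms(4))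
  also have "\<dots> \<le> of_nat (card G) * B"
    by (rule sum_bounded_above) (simp add: B_def assms(2))
  finally have "K \<le> B"
    using assms(2,3) by (subst (asm) ennreal_mult_le_mult_iff) auto
  moreover have "B \<in> (\<lambda>g. \<integral>\<^sup>+w. \<phi> g w \<partial>N) ` G"
    unfolding B_def using assms(2,3) by (intro Max_in) auto
  ultimately show ?thesis
    by auto
qed

lemma ennreal_le_ennreal_sqrt:
  assumes "ennreal (x\<^sup>2) \<le> y"
  shows "ennreal x \<le> ennreal_sqrt y"
proof (cases y)
  case (real r)
  then have "x\<^sup>2 \<le> r"
    using assms by simp
  then have "x \<le> sqrt r"
    by (rule real_le_rsqrt)
  with real show ?thesis
    by (simp add: ennreal_sqrt_def ennreal_leI)
qed (simp add: ennreal_sqrt_def)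

text \<open>
  Put \<open>N = 2n\<close> and let \<open>t = (C - 1) m\<close> be the mass that the heavy cells add to \<open>N\<close>. If
  \<open>N \<ge> C - 1\<close>, the claim reads \<open>(N + t)\<^sup>2 \<le> 9 N C m\<close>, which follows from \<open>(N + t)\<^sup>2 \<le> 9 N t\<close>.
  The values \<open>N/2 \<le> t \<le> N\<close> satisfy this, and rounding \<open>N / (C - 1)\<close> down to \<open>m\<close>
  achieves them. For \<open>C \<le> 2\<close> this \<open>m\<close> might exceed the number of cells; then \<open>m = N\<close> works,
  as the claim becomes \<open>C \<le> 9\<close>. If \<open>N < C - 1\<close>, one heavy cell already outweighs all others, and
  \<open>m = 1\<close> gives the bound with equality.
\<close>

lemma exists_good_support_size:
  fixes C :: real and n :: nat
  assumes "n \<ge> 1" "C \<ge> 1"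
  shows "\<exists>m\<le>2 * n. (sqrt 2 / 6 *
      (if 2 * real n \<ge> C - 1 then sqrt (C / (2 * real n)) else 3 * C / (C + 2 * real n - 1)))\<^sup>2
    \<le> (C / (2 * real n + (C - 1) * real m))\<^sup>2 * (real m / 2)"
proof (cases "2 * real n \<ge> C - 1")
  case False
  have sq: "(sqrt 2 / 6 * (3 * C / D))\<^sup>2 = (C / D)\<^sup>2 * (real 1 / 2)" for D
    by (simp add: power_mult_distrib power_divide)
  have D: "2 * real n + (C - 1) * real 1 = C + 2 * real n - 1"
    by simp
  have "(sqrt 2 / 6 * (3 * C / (C + 2 * real n - 1)))\<^sup>2
      = (C / (2 * real n + (C - 1) * real 1))\<^sup>2 * (real 1 / 2)"
    unfolding D by (rule sq)
  with False assms(1) show ?thesis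
    by (intro exI[of _ 1]) simp
next
  case True
  have sq: "(sqrt 2 / 6 * sqrt (C / (2 * real n)))\<^sup>2 = C / (36 * real n)"
    using assms by (simp add: power_mult_distrib power_divide)
  have *: "C / (36 * real n) \<le> (C / D)\<^sup>2 * (real m / 2)"
    if "0 < D" "D\<^sup>2 \<le> 18 * real n * (C * real m)" for D m
  proof -
    have "C * D\<^sup>2 \<le> C * (18 * real n * (C * real m))"
      using that assms by (intro mult_left_mono) auto
    then have "C * D\<^sup>2 / (36 * real n * D\<^sup>2) \<le> C * (18 * real n * (C * real m)) / (36 * real n * D\<^sup>2)"
      by (rule divide_right_mono) simp
    moreover have "C * D\<^sup>2 / (36 * real n * D\<^sup>2) = C / (36 * real n)"
      using that by simp
    moreover have "C * (18 * real n * (C * real m)) / (36 * real n * D\<^sup>2) = (C / D)\<^sup>2 * (real m / 2)"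
      using that assms by (simp add: field_simps power2_eq_square)
    ultimately show ?thesis
      by linarith
  qed
  have "\<exists>m\<le>2 * n. 0 < 2 * real n + (C - 1) * real m \<and>
      (2 * real n + (C - 1) * real m)\<^sup>2 \<le> 18 * real n * (C * real m)"
  proof (cases "C \<le> 2")
    case True
    have "(2 * real n + (C - 1) * real (2 * n))\<^sup>2 = (4 * C * (real n)\<^sup>2) * C"
      by (simp add: power2_eq_square algebra_simps)
    also have "\<dots> \<le> (4 * C * (real n)\<^sup>2) * 9"
      using True assms by (intro mult_left_mono) auto
    also have "\<dots> = 18 * real n * (C * real (2 * n))"
      by (simp add: power2_eq_square)
    finally show ?thesis
      using assms by (intro exI[of _ "2 * n"]) (simp add: add_pos_nonneg)
  next
    case False
    define m where "m = nat \<lfloor>2 * real n / (C - 1)\<rfloor>"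
    define t where "t = (C - 1) * real m"
    have q: "1 \<le> 2 * real n / (C - 1)"
      using True False by (simp add: field_simps)
    then have "1 \<le> \<lfloor>2 * real n / (C - 1)\<rfloor>"
      by (simp add: le_floor_iff)
    then have "real m = of_int \<lfloor>2 * real n / (C - 1)\<rfloor>" and m1: "1 \<le> real m"
      unfolding m_def by linarith+
    then have m: "real m \<le> 2 * real n / (C - 1)" "2 * real n / (C - 1) < real m + 1"
      by linarith+
    \<comment> \<open>Rounding loses less than \<open>C - 1 \<le> t\<close>, so \<open>t > n\<close>.\<close>
    have t: "t \<le> 2 * real n" "2 * real n < t + (C - 1)"
      using m False by (simp_all add: t_def field_simps)
    have "(C - 1) * 1 \<le> t"
      unfolding t_def using m1 False by (intro mult_left_mono) auto
    then have t1: "C - 1 \<le> t"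
      by simp
    have "2 * real n * 1 \<le> 2 * real n * (C - 1)"
      using False by (intro mult_left_mono) auto
    then have "2 * real n / (C - 1) \<le> 2 * real n"
      using False by (simp add: divide_le_eq)
    then have "m \<le> 2 * n"
      using m(1) by linarith
    moreover have "0 < 2 * real n + t"
      using t1 False by linarith
    moreover have "(2 * real n + t)\<^sup>2 \<le> 18 * real n * (C * real m)"
    proof -
      have "(2 * real n + t)\<^sup>2 \<le> (4 * real n)\<^sup>2"
        using t t1 False by (intro power_mono) auto
      also have "\<dots> = 18 * real n * (8 / 9 * real n)"
        by (simp add: power2_eq_square)
      also have "\<dots> \<le> 18 * real n * (C * real m)"
      proof (rule mult_left_mono)
        have "t \<le> C * real m"
          by (simp add: t_def algebra_simps)
        then show "8 / 9 * real n \<le> C * real m"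
          using t t1 by linarith
      qed simp
      finally show ?thesis .
    qed
    ultimately show ?thesis
      by (auto simp: t_def)
  qed
  then show ?thesis
    using True sq * by auto
qed

theorem theorem1:
  fixes M :: "'a measure" and n :: nat and C :: real and \<A> :: "'a set set"
    and S :: "('a, 'w, 'r) monte_carlo"
  assumes "prob_space M"
    and "n \<ge> 1"
    and "C \<ge> 1"
    and "partition_on (space M) \<A>"
    and "card \<A> = 2 * n"
    and "\<And>A. A \<in> \<A> \<Longrightarrow> A \<in> sets M"
    and "\<And>A. A \<in> \<A> \<Longrightarrow> measure M A = 1 / (2 * real n)"
    and "is_monte_carlo_method M (input_class M C) n S"
  shows "worst_case_error M (input_class M C) S n \<ge>
    ennreal (sqrt 2 / 6 *
      (if 2 * real n \<ge> C - 1 then sqrt (C / (2 * real n))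
       else 3 * C / (C + 2 * real n - 1)))"
proof -
  define b where "b = sqrt 2 / 6 *
      (if 2 * real n \<ge> C - 1 then sqrt (C / (2 * real n)) else 3 * C / (C + 2 * real n - 1))"
  obtain m where m: "m \<le> 2 * n" "b\<^sup>2 \<le> (C / (2 * real n + (C - 1) * real m))\<^sup>2 * (real m / 2)"
    using exists_good_support_size[OF assms(2,3)] unfolding b_def by blast
  define G where "G = sparse_signs \<A> m"
  define f where "f g = step_function \<A> g" for g
  define \<rho> where "\<rho> g = step_function \<A> (sign_density C g)" for g
  define err where "err g w = \<bar>solution M (f g) (\<rho> g) - mc_output S n (f g) (\<rho> g) w\<bar>\<^sup>2" for g w
  have fin: "finite \<A>"
    using assms(2,5) by (intro card_ge_0_finite) simp
  have G: "finite G" "G \<noteq> {}"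
    using fin m(1) assms(5) by (simp_all add: G_def finite_sparse_signs sparse_signs_nonempty)
  have inp: "(f g, \<rho> g) \<in> input_class M C" if "g \<in> G" for g
    using step_function_input_class[OF assms(4) fin assms(6) assms(3)] that
    by (simp add: f_def \<rho>_def G_def)
  have "\<exists>g\<in>G. ennreal (b\<^sup>2) \<le> (\<integral>\<^sup>+w. ennreal (err g w) \<partial>rng S)"
  proof (rule exists_nn_integral_ge_average)
    show "prob_space (rng S)"
      using assms(8) by (simp add: is_monte_carlo_method_def)
    show "(\<lambda>w. ennreal (err g w)) \<in> borel_measurable (rng S)" if "g \<in> G" for g
    proof -
      have "mc_output S n (f g) (\<rho> g) \<in> borel_measurable (rng S)"
        using assms(8) inp[OF that] unfolding is_monte_carlo_method_def by blast
      then show ?thesis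
        unfolding err_def by measurable
    qed
    show "of_nat (card G) * ennreal (b\<^sup>2) \<le> (\<Sum>g\<in>G. ennreal (err g w))" if w: "w \<in> space (rng S)" for w
    proof -
      have "real (card G) * b\<^sup>2 \<le> card G * ((C / (2 * real n + (C - 1) * real m))\<^sup>2 * (real m / 2))"
        using m(2) by (rule mult_left_mono) simp
      also have "\<dots> = card G * ((C / (card \<A> + (C - 1) * m))\<^sup>2 * (real m * (real (card \<A>) - n) / card \<A>))"
        using assms(2,5) by simp
      also have "\<dots> \<le> (\<Sum>g\<in>G. err g w)"
        unfolding G_def err_def f_def \<rho>_def
        by (rule sum_square_error_ge[OF prob_space.finite_measure[OF assms(1)] _ assms(4) fin assms(6,7) _ assms(8) w])
          (use assms(2,3,5) in \<open>auto intro: add_pos_nonneg\<close>)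
      finally have "ennreal (real (card G) * b\<^sup>2) \<le> ennreal (\<Sum>g\<in>G. err g w)"
        by (rule ennreal_leI)
      then show ?thesis
        by (simp add: ennreal_mult err_def sum_ennreal ennreal_of_nat_eq_real_of_nat)
    qed
  qed (use G in auto)
  then obtain g where g: "g \<in> G" "ennreal (b\<^sup>2) \<le> (\<integral>\<^sup>+w. ennreal (err g w) \<partial>rng S)"
    by blast
  have "ennreal b \<le> mc_error M S n (f g) (\<rho> g)"
    using ennreal_le_ennreal_sqrt[OF g(2)] by (simp add: mc_error_def err_def)
  also have "\<dots> \<le> worst_case_error M (input_class M C) S n"
    unfolding worst_case_error_def by (rule SUP_upper2[OF inp[OF g(1)]]) simp
  finally show ?thesis
    by (simp add: b_def)
qed

end
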